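(* Let $X \xrightarrow{f} Z \xleftarrow{g} Y$ and $X' \xrightarrow{f'} Z' \xleftarrow{g'} Y'$ be continuous maps, and suppose that the product $X\times Y\times X'\times Y'$ is normal. Then $$\mathrm{TC}(f\times f',\,g\times g')\ \le\ \mathrm{TC}(f,g)+\mathrm{TC}(f',g'),$$ where $f\times f'\colon X\times X'\to Z\times Z'$ and $g\times g'\colon Y\times Y'\to Z\times Z'$ are the product maps.
   Context: A normal space is, by definition, required to be Hausdorff. All maps are continuous, $I=[0,1]$, and path spaces $X^I$ carry the compact-open topology. For a map $p\colon E\to B$, the sectional number $\mathrm{sec}(p)$ is the least integer $k\ge 0$ such that $B$ has an open cover $U_0,\dots,U_k$ with continuous maps $s_i\colon U_i\to E$ satisfying $p\circ s_i=\mathrm{inc}_{U_i}$ (strict equality); $\mathrm{sec}(p)=\infty$ if no such $k$ exists. For maps $f\colon X\to Z$, $g\colon Y\to Z$ put $\Delta^I_{f,g}=\{(\alpha,\beta)\in X^I\times Y^I : f\circ\alpha=g\circ\beta\}$ and $\pi_{f,g}\colon\Delta^I_{f,g}\to X\times Y$, $\pi_{f,g}(\alpha,\beta)=(\alpha(0),\beta(1))$. The bivariate topological complexity is $\mathrm{TC}(f,g):=\mathrm{sec}(\pi_{f,g})$. *)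

theory Defs
  imports "HOL-Analysis.Analysis" "HOL-Library.Extended_Nat"
begin

text \<open>
  Spaces are abstract topologies, so that carriers need not be whole types and may be empty.
\<close>

text \<open>
  Continuous maps are represented by functions that are \<open>undefined\<close> outside \<open>topspace A\<close>, so that
  equality in HOL is equality of maps with domain \<open>A\<close>.
\<close>

definition continuous_maps :: "'a topology \<Rightarrow> 'b topology \<Rightarrow> ('a \<Rightarrow> 'b) set" where
  "continuous_maps A X = {h \<in> extensional (topspace A). continuous_map A X h}"

definition compact_open_topology :: "'a topology \<Rightarrow> 'b topology \<Rightarrow> ('a \<Rightarrow> 'b) topology" where
  "compact_open_topology A X = topology_generated_by
     {{h \<in> continuous_maps A X. h ` K \<subseteq> U} |K U. compactin A K \<and> openin X U}"

lemma topspace_compact_open_topology: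
  "topspace (compact_open_topology A X) = continuous_maps A X"
proof -
  have "continuous_maps A X = {h \<in> continuous_maps A X. h ` {} \<subseteq> topspace X}"
    by auto
  then have "continuous_maps A X \<in>
      {{h \<in> continuous_maps A X. h ` K \<subseteq> U} |K U. compactin A K \<and> openin X U}"
    using compactin_empty[of A] openin_topspace[of X] by blast
  then show ?thesis
    unfolding compact_open_topology_def topology_generated_by_topspace by blast
qed

definition path_space :: "'a topology \<Rightarrow> (real \<Rightarrow> 'a) topology" where
  "path_space X = compact_open_topology (top_of_set {0..1}) X"

text \<open>
  The infimum is taken in \<open>enat\<close>, where \<open>Inf {} = \<infinity>\<close>.
\<close>

definition sectional_number :: "'e topology \<Rightarrow> 'b topology \<Rightarrow> ('e \<Rightarrow> 'b) \<Rightarrow> enat" where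
  "sectional_number E B p = Inf {enat k |k.
     \<exists>(U :: nat \<Rightarrow> 'b set) (s :: nat \<Rightarrow> 'b \<Rightarrow> 'e).
       (\<Union>i\<le>k. U i) = topspace B \<and>
       (\<forall>i\<le>k. openin B (U i) \<and> continuous_map (subtopology B (U i)) E (s i) \<and>
              (\<forall>b\<in>U i. p (s i b) = b))}"

text \<open>
  The topology of the common codomain \<open>Z\<close> of \<open>f\<close> and \<open>g\<close> does not enter the next definitions:
  it matters only for the continuity of \<open>f\<close> and \<open>g\<close>.
\<close>

definition path_pairs ::
    "'x topology \<Rightarrow> 'y topology \<Rightarrow> ('x \<Rightarrow> 'z) \<Rightarrow> ('y \<Rightarrow> 'z) \<Rightarrow> ((real \<Rightarrow> 'x) \<times> (real \<Rightarrow> 'y)) topology" where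
  "path_pairs X Y f g =
     subtopology (prod_topology (path_space X) (path_space Y))
       {(\<alpha>, \<beta>). \<forall>t\<in>{0..1}. f (\<alpha> t) = g (\<beta> t)}"

definition endpoint_map :: "(real \<Rightarrow> 'x) \<times> (real \<Rightarrow> 'y) \<Rightarrow> 'x \<times> 'y" where
  "endpoint_map = (\<lambda>(\<alpha>, \<beta>). (\<alpha> 0, \<beta> 1))"

definition bivariate_TC ::
    "'x topology \<Rightarrow> 'y topology \<Rightarrow> ('x \<Rightarrow> 'z) \<Rightarrow> ('y \<Rightarrow> 'z) \<Rightarrow> enat" where
  "bivariate_TC X Y f g =
     sectional_number (path_pairs X Y f g) (prod_topology X Y) endpoint_map"

end

theory Submission imports Defs
begin

text \<open>
  Sectional numbers are subadditive over a normal base.  Let \<open>U\<^sub>0, \<dots>, U\<^sub>m\<close> and \<open>V\<^sub>0, \<dots>, V\<^sub>n\<close> be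
  open covers of a normal space, and choose continuous real functions \<open>\<phi>\<^sub>i, \<psi>\<^sub>j\<close>, positive only inside
  \<open>U\<^sub>i\<close> and \<open>V\<^sub>j\<close> respectively, such that at each point some \<open>\<phi>\<^sub>i\<close> and some \<open>\<psi>\<^sub>j\<close> are positive.  The
  open sets
  \<open>G\<^sub>i\<^sub>j = {\<phi>\<^sub>i > 0, \<psi>\<^sub>j > 0, \<phi>\<^sub>i > \<psi>\<^sub>l for l < j, \<psi>\<^sub>j > \<phi>\<^sub>l for l < i}\<close>
  refine both covers, and they cover the space: take for \<open>i\<close> and \<open>j\<close> the first indices at which
  \<open>\<phi>\<^sub>i\<close> and \<open>\<psi>\<^sub>j\<close> are positive, so that all earlier functions are \<open>\<le> 0\<close> there.
  If \<open>i < i'\<close> and \<open>j' < j\<close>, then \<open>\<phi>\<^sub>i > \<psi>\<^sub>j\<^sub>'\<close> on \<open>G\<^sub>i\<^sub>j\<close> whereas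
  \<open>\<psi>\<^sub>j\<^sub>' > \<phi>\<^sub>i\<close> on \<open>G\<^sub>i\<^sub>'\<^sub>j\<^sub>'\<close>; so sets with the same \<open>i + j\<close> are disjoint, and sections over them
  glue.  This leaves \<open>m + n + 1\<close> open sets carrying sections (lemmas
  \<open>antidiagonal_refinement\<close> and \<open>sectional_number_le_add\<close>).

  For the bivariate complexity, a pair of local sections is turned into one by pairing paths
  pointwise, which is continuous for the compact-open topologies
  (\<open>continuous_map_compact_open_pair\<close>).
\<close>

section \<open>Refining two open covers of a normal space\<close>

text \<open>
  The functions are built one at a time: the next one is a Urysohn function for the closed set of
  points that are covered neither by the earlier positivity sets nor by the later \<open>U i\<close>.
\<close>

lemma subordinate_functions:
  fixes U :: "nat \<Rightarrow> 'a set"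
  assumes W: "normal_space W"
    and op: "\<And>i. i \<le> m \<Longrightarrow> openin W (U i)"
    and cov: "(\<Union>i\<le>m. U i) = topspace W"
  obtains \<phi> :: "nat \<Rightarrow> 'a \<Rightarrow> real"
  where "\<And>i. i \<le> m \<Longrightarrow> continuous_map W euclideanreal (\<phi> i)"
    and "\<And>i x. i \<le> m \<Longrightarrow> x \<in> topspace W \<Longrightarrow> 0 < \<phi> i x \<Longrightarrow> x \<in> U i"
    and "\<And>x. x \<in> topspace W \<Longrightarrow> \<exists>i\<le>m. 0 < \<phi> i x"
proof -
  define good :: "nat \<Rightarrow> ('a \<Rightarrow> real) \<Rightarrow> bool" where
    "good i f \<longleftrightarrow> continuous_map W euclideanreal f \<and>
       (\<forall>x\<in>topspace W. 0 < f x \<longrightarrow> x \<in> U i)" for i f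
  have "\<exists>\<phi>. (\<forall>i<k. good i (\<phi> i)) \<and>
      (\<forall>x\<in>topspace W. (\<exists>i<k. 0 < \<phi> i x) \<or> (\<exists>i. k \<le> i \<and> i \<le> m \<and> x \<in> U i))"
    if "k \<le> Suc m" for k
    using that
  proof (induction k)
    case 0
    show ?case using cov by fastforce
  next
    case (Suc k)
    then obtain \<phi> where good: "\<And>i. i < k \<Longrightarrow> good i (\<phi> i)"
      and \<phi>: "\<And>x. x \<in> topspace W \<Longrightarrow> (\<exists>i<k. 0 < \<phi> i x) \<or> (\<exists>i. k \<le> i \<and> i \<le> m \<and> x \<in> U i)"
      by (metis Suc_leD)
    define P where "P = (\<Union>i<k. {x \<in> topspace W. \<phi> i x \<in> {0<..}}) \<union> (\<Union>i\<in>{Suc k..m}. U i)"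
    have "openin W {x \<in> topspace W. \<phi> i x \<in> {0<..}}" if "i < k" for i
      using good[OF that] by (intro openin_continuous_map_preimage) (auto simp: good_def)
    then have "openin W P"
      unfolding P_def using op by (intro openin_Un openin_Union) auto
    then have cl: "closedin W (topspace W - U k)" "closedin W (topspace W - P)"
      using op Suc.prems by auto
    have "disjnt (topspace W - U k) (topspace W - P)"
      using \<phi> by (force simp: disjnt_iff P_def Suc_le_eq le_less)
    then obtain h where h: "continuous_map W (top_of_set {0..1::real}) h"
      "h ` (topspace W - U k) \<subseteq> {0}" "h ` (topspace W - P) \<subseteq> {1}"
      using Urysohn_lemma[OF W cl] by (metis zero_le_one)
    have "continuous_map W euclideanreal h"
      using h(1) unfolding continuous_map_in_subtopology by blast
    moreover have "h x = 0" if "x \<in> topspace W" "x \<notin> U k" for x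
      using h(2) that by blast
    ultimately have "good k h"
      unfolding good_def by (metis less_irrefl)
    moreover have "(\<exists>i<Suc k. 0 < (\<phi>(k := h)) i x) \<or> (\<exists>i. Suc k \<le> i \<and> i \<le> m \<and> x \<in> U i)"
      if "x \<in> topspace W" for x
    proof (cases "x \<in> P")
      case True
      then show ?thesis unfolding P_def by (auto simp: less_Suc_eq)
    next
      case False
      then have "h x = 1" using that h(3) by auto
      then show ?thesis by auto
    qed
    ultimately show ?case
      using good by (intro exI[of _ "\<phi>(k := h)"]) (auto simp: less_Suc_eq)
  qed
  from this[of "Suc m"] obtain \<phi> where "\<And>i. i \<le> m \<Longrightarrow> good i (\<phi> i)"
    and "\<And>x. x \<in> topspace W \<Longrightarrow> \<exists>i\<le>m. 0 < \<phi> i x"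
    by (force simp: less_Suc_eq_le)
  then show ?thesis
    using that unfolding good_def by blast
qed

text \<open>
  The sets \<open>G i j\<close> with fixed \<open>i + j\<close> are pairwise disjoint, so their union can serve as one member
  of a cover; \<open>i + j\<close> takes \<open>m + n + 1\<close> values, which is where the sum of the two numbers comes from.
\<close>

lemma antidiagonal_refinement:
  fixes U V :: "nat \<Rightarrow> 'a set"
  assumes W: "normal_space W"
    and U: "\<And>i. i \<le> m \<Longrightarrow> openin W (U i)" "(\<Union>i\<le>m. U i) = topspace W"
    and V: "\<And>j. j \<le> n \<Longrightarrow> openin W (V j)" "(\<Union>j\<le>n. V j) = topspace W"
  obtains G :: "nat \<Rightarrow> nat \<Rightarrow> 'a set"
  where "\<And>i j. i \<le> m \<Longrightarrow> j \<le> n \<Longrightarrow> openin W (G i j)"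
    and "\<And>i j. i \<le> m \<Longrightarrow> j \<le> n \<Longrightarrow> G i j \<subseteq> U i \<inter> V j"
    and "\<And>x. x \<in> topspace W \<Longrightarrow> \<exists>i\<le>m. \<exists>j\<le>n. x \<in> G i j"
    and "\<And>i j i' j'. i + j = i' + j' \<Longrightarrow> i \<noteq> i' \<Longrightarrow> G i j \<inter> G i' j' = {}"
proof -
  obtain \<phi> where \<phi>: "\<And>i. i \<le> m \<Longrightarrow> continuous_map W euclideanreal (\<phi> i)"
    and \<phi>U: "\<And>i x. i \<le> m \<Longrightarrow> x \<in> topspace W \<Longrightarrow> 0 < \<phi> i x \<Longrightarrow> x \<in> U i"
    and \<phi>pos: "\<And>x. x \<in> topspace W \<Longrightarrow> \<exists>i\<le>m. 0 < \<phi> i x"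
    using subordinate_functions[OF W U] by blast
  obtain \<psi> where \<psi>: "\<And>j. j \<le> n \<Longrightarrow> continuous_map W euclideanreal (\<psi> j)"
    and \<psi>V: "\<And>j x. j \<le> n \<Longrightarrow> x \<in> topspace W \<Longrightarrow> 0 < \<psi> j x \<Longrightarrow> x \<in> V j"
    and \<psi>pos: "\<And>x. x \<in> topspace W \<Longrightarrow> \<exists>j\<le>n. 0 < \<psi> j x"
    using subordinate_functions[OF W V] by blast
  define pos where "pos f = {x \<in> topspace W. f x \<in> {0::real<..}}" for f
  have pos: "openin W (pos f)" if "continuous_map W euclideanreal f" for f
    unfolding pos_def using that by (intro openin_continuous_map_preimage) auto
  define G where "G i j = (pos (\<phi> i) \<inter> pos (\<psi> j)) \<inter>
     (\<Inter>l<j. pos (\<lambda>x. \<phi> i x - \<psi> l x)) \<inter> (\<Inter>l<i. pos (\<lambda>x. \<psi> j x - \<phi> l x))" for i j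
  have G_iff: "x \<in> G i j \<longleftrightarrow> x \<in> topspace W \<and> 0 < \<phi> i x \<and> 0 < \<psi> j x \<and>
      (\<forall>l<j. \<psi> l x < \<phi> i x) \<and> (\<forall>l<i. \<phi> l x < \<psi> j x)" for x i j
    unfolding G_def pos_def by auto
  show ?thesis
  proof
    fix i j assume ij: "i \<le> m" "j \<le> n"
    have 1: "openin W (pos (\<phi> i) \<inter> pos (\<psi> j))"
      using ij \<phi> \<psi> pos by blast
    have 2: "openin W (P \<inter> (\<Inter>l<k. pos (h l)))"
      if "openin W P" "\<And>l. l < k \<Longrightarrow> continuous_map W euclideanreal (h l)" for P h and k :: nat
      using that(2)
    proof (induction k)
      case 0
      then show ?case using that(1) by simp
    next
      case (Suc k)
      have "P \<inter> (\<Inter>l<Suc k. pos (h l)) = (P \<inter> (\<Inter>l<k. pos (h l))) \<inter> pos (h k)"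
        by (auto simp: less_Suc_eq)
      then show ?case using Suc pos by (auto intro!: openin_Int)
    qed
    show "openin W (G i j)"
      unfolding G_def using ij
      by (intro 2 1 continuous_map_diff \<phi> \<psi>) auto
    show "G i j \<subseteq> U i \<inter> V j"
      using ij \<phi>U \<psi>V by (auto simp: G_iff)
  next
    fix x assume x: "x \<in> topspace W"
    define i where "i = (LEAST i. 0 < \<phi> i x)"
    define j where "j = (LEAST j. 0 < \<psi> j x)"
    have i: "i \<le> m" "0 < \<phi> i x" and il: "\<And>l. l < i \<Longrightarrow> \<phi> l x \<le> 0"
      using \<phi>pos[OF x] unfolding i_def
      by (meson LeastI Least_le order_trans, meson LeastI, meson not_less_Least not_less)
    have j: "j \<le> n" "0 < \<psi> j x" and jl: "\<And>l. l < j \<Longrightarrow> \<psi> l x \<le> 0"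
      using \<psi>pos[OF x] unfolding j_def
      by (meson LeastI Least_le order_trans, meson LeastI, meson not_less_Least not_less)
    have "x \<in> G i j"
      using x i j il jl by (force simp: G_iff)
    then show "\<exists>i\<le>m. \<exists>j\<le>n. x \<in> G i j" using i j by blast
  next
    have disj: "G i j \<inter> G i' j' = {}" if "i < i'" "j' < j" for i j i' j'
      using that by (fastforce simp: G_iff)
    show "G i j \<inter> G i' j' = {}" if "i + j = i' + j'" "i \<noteq> i'" for i j i' j'
    proof (cases "i < i'")
      case True
      then show ?thesis using that by (intro disj) auto
    next
      case False
      then have "G i' j' \<inter> G i j = {}" using that by (intro disj) auto
      then show ?thesis by blast
    qed
  qed
qed

section \<open>Subadditivity of the sectional number\<close>

lemma sectional_number_attained:
  assumes "sectional_number E B p = enat k"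
  obtains U s where "(\<Union>i\<le>k. U i) = topspace B"
    and "\<And>i. i \<le> k \<Longrightarrow> openin B (U i)"
    and "\<And>i. i \<le> k \<Longrightarrow> continuous_map (subtopology B (U i)) E (s i)"
    and "\<And>i b. i \<le> k \<Longrightarrow> b \<in> U i \<Longrightarrow> p (s i b) = b"
proof -
  let ?P = "\<lambda>k. \<exists>(U :: nat \<Rightarrow> 'b set) (s :: nat \<Rightarrow> 'b \<Rightarrow> 'a).
     (\<Union>i\<le>k. U i) = topspace B \<and> (\<forall>i\<le>k. openin B (U i) \<and>
       continuous_map (subtopology B (U i)) E (s i) \<and> (\<forall>b\<in>U i. p (s i b) = b))"
  have *: "Inf {enat k |k. ?P k} = enat k"
    using assms unfolding sectional_number_def .
  then have "{enat k |k. ?P k} \<noteq> {}"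
    unfolding Inf_enat_def by (metis enat.distinct(1))
  then have "Inf {enat k |k. ?P k} \<in> {enat k |k. ?P k}"
    unfolding Inf_enat_def by (metis (mono_tags, lifting) LeastI ex_in_conv)
  then have "?P k" unfolding * by blast
  then obtain U s where cov: "(\<Union>i\<le>k. U i) = topspace B"
    and sec: "\<forall>i\<le>k. openin B (U i) \<and> continuous_map (subtopology B (U i)) E (s i) \<and>
       (\<forall>b\<in>U i. p (s i b) = b)"
    by (elim exE conjE) (rule that)
  show ?thesis
    by (rule that[of U s]) (use cov sec in auto)
qed

text \<open>
  Pulled back along \<open>q1\<close> and \<open>q2\<close>, sections of \<open>p1\<close> and \<open>p2\<close> combine through \<open>c\<close> into sections of
  \<open>p\<close>.  The case in mind is \<open>p1 \<times> p2\<close>; arbitrary \<open>q1\<close> and \<open>q2\<close> allow the factors of the product to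
  be rearranged.
\<close>

lemma sectional_number_le_add:
  assumes W: "normal_space W"
    and q: "continuous_map W B1 q1" "continuous_map W B2 q2"
    and c: "continuous_map (prod_topology E1 E2) E c"
    and pc: "\<And>w e1 e2. w \<in> topspace W \<Longrightarrow> e1 \<in> topspace E1 \<Longrightarrow> e2 \<in> topspace E2 \<Longrightarrow>
       p1 e1 = q1 w \<Longrightarrow> p2 e2 = q2 w \<Longrightarrow> p (c (e1, e2)) = w"
  shows "sectional_number E W p \<le> sectional_number E1 B1 p1 + sectional_number E2 B2 p2"
proof (cases "sectional_number E1 B1 p1 + sectional_number E2 B2 p2")
  case infinity
  then show ?thesis by simp
next
  case (enat N)
  then obtain m n where m: "sectional_number E1 B1 p1 = enat m"
    and n: "sectional_number E2 B2 p2 = enat n"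
    by (metis enat.exhaust plus_enat_simps(2,3) enat.distinct(1))
  obtain U s where U: "(\<Union>i\<le>m. U i) = topspace B1" "\<And>i. i \<le> m \<Longrightarrow> openin B1 (U i)"
    and s: "\<And>i. i \<le> m \<Longrightarrow> continuous_map (subtopology B1 (U i)) E1 (s i)"
    and ps: "\<And>i b. i \<le> m \<Longrightarrow> b \<in> U i \<Longrightarrow> p1 (s i b) = b"
    using sectional_number_attained[OF m] by blast
  obtain V t where V: "(\<Union>j\<le>n. V j) = topspace B2" "\<And>j. j \<le> n \<Longrightarrow> openin B2 (V j)"
    and t: "\<And>j. j \<le> n \<Longrightarrow> continuous_map (subtopology B2 (V j)) E2 (t j)"
    and pt: "\<And>j b. j \<le> n \<Longrightarrow> b \<in> V j \<Longrightarrow> p2 (t j b) = b"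
    using sectional_number_attained[OF n] by blast
  define U' where "U' i = {w \<in> topspace W. q1 w \<in> U i}" for i
  define V' where "V' j = {w \<in> topspace W. q2 w \<in> V j}" for j
  have U': "openin W (U' i)" if "i \<le> m" for i
    unfolding U'_def using q U that by (blast intro: openin_continuous_map_preimage)
  have V': "openin W (V' j)" if "j \<le> n" for j
    unfolding V'_def using q V that by (blast intro: openin_continuous_map_preimage)
  have covU: "(\<Union>i\<le>m. U' i) = topspace W"
    using U(1) continuous_map_image_subset_topspace[OF q(1)] unfolding U'_def by blast
  have covV: "(\<Union>j\<le>n. V' j) = topspace W"
    using V(1) continuous_map_image_subset_topspace[OF q(2)] unfolding V'_def by blast
  obtain G where G: "\<And>i j. i \<le> m \<Longrightarrow> j \<le> n \<Longrightarrow> openin W (G i j)"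
    "\<And>i j. i \<le> m \<Longrightarrow> j \<le> n \<Longrightarrow> G i j \<subseteq> U' i \<inter> V' j"
    "\<And>x. x \<in> topspace W \<Longrightarrow> \<exists>i\<le>m. \<exists>j\<le>n. x \<in> G i j"
    "\<And>i j i' j'. i + j = i' + j' \<Longrightarrow> i \<noteq> i' \<Longrightarrow> G i j \<inter> G i' j' = {}"
    using antidiagonal_refinement[OF W U' covU V' covV] by blast
  define r where "r i j w = c (s i (q1 w), t j (q2 w))" for i j w
  have cont_r: "continuous_map (subtopology W (G i j)) E (r i j)"
    and pr: "\<And>w. w \<in> G i j \<Longrightarrow> p (r i j w) = w" if ij: "i \<le> m" "j \<le> n" for i j
  proof -
    have q1: "continuous_map (subtopology W (G i j)) (subtopology B1 (U i)) q1"
      using q(1) G(2)[OF ij]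
      by (auto simp: continuous_map_in_subtopology U'_def intro: continuous_map_from_subtopology)
    have q2: "continuous_map (subtopology W (G i j)) (subtopology B2 (V j)) q2"
      using q(2) G(2)[OF ij]
      by (auto simp: continuous_map_in_subtopology V'_def intro: continuous_map_from_subtopology)
    have "continuous_map (subtopology W (G i j)) (prod_topology E1 E2)
        (\<lambda>w. (s i (q1 w), t j (q2 w)))"
      using continuous_map_compose[OF q1 s[OF ij(1)]] continuous_map_compose[OF q2 t[OF ij(2)]]
      by (simp add: continuous_map_pairedI o_def)
    from continuous_map_compose[OF this c]
    show "continuous_map (subtopology W (G i j)) E (r i j)"
      by (simp add: o_def r_def[abs_def])
    fix w assume w: "w \<in> G i j"
    then have w': "w \<in> topspace W" "q1 w \<in> U i" "q2 w \<in> V j"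
      using G(2)[OF ij] by (auto simp: U'_def V'_def)
    then have "s i (q1 w) \<in> topspace E1" "t j (q2 w) \<in> topspace E2"
      using continuous_map_image_subset_topspace[OF s[OF ij(1)]]
        continuous_map_image_subset_topspace[OF t[OF ij(2)]]
        openin_subset[OF U(2)[OF ij(1)]] openin_subset[OF V(2)[OF ij(2)]]
      unfolding topspace_subtopology by blast+
    then show "p (r i j w) = w"
      unfolding r_def using w' ps[OF ij(1)] pt[OF ij(2)] by (intro pc) auto
  qed
  \<comment> \<open>\<open>I k\<close> indexes the antidiagonal \<open>i + j = k\<close>; \<open>i \<le> k\<close> keeps \<open>k - i\<close> from truncating.\<close>
  define I where "I k = {i. i \<le> m \<and> i \<le> k \<and> k - i \<le> n}" for k
  define D where "D k = (\<Union>i\<in>I k. G i (k - i))" for k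
  have opD: "openin W (D k)" for k
    unfolding D_def I_def using G(1) by (intro openin_Union) auto
  have "\<exists>\<sigma>. continuous_map (subtopology W (D k)) E \<sigma> \<and> (\<forall>w\<in>D k. p (\<sigma> w) = w)" for k
  proof -
    have sub: "subtopology (subtopology W (D k)) (G i (k - i)) = subtopology W (G i (k - i))"
      if "i \<in> I k" for i
    proof -
      have "D k \<inter> G i (k - i) = G i (k - i)"
        using that unfolding D_def by blast
      then show ?thesis by (simp add: subtopology_subtopology)
    qed
    obtain \<sigma> where \<sigma>: "continuous_map (subtopology W (D k)) E \<sigma>"
      and \<sigma>r: "\<And>w i. i \<in> I k \<Longrightarrow> w \<in> topspace (subtopology W (D k)) \<inter> G i (k - i) \<Longrightarrow>
          \<sigma> w = r i (k - i) w"
    proof (rule pasting_lemma_exists[where X = "subtopology W (D k)" and I = "I k"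
          and T = "\<lambda>i. G i (k - i)" and Y = E and f = "\<lambda>i. r i (k - i)"])
      show "topspace (subtopology W (D k)) \<subseteq> (\<Union>i\<in>I k. G i (k - i))"
        by (auto simp: D_def)
      show "openin (subtopology W (D k)) (G i (k - i))" if "i \<in> I k" for i
        using that G(1)[of i "k - i"] opD
        by (auto simp: openin_open_subtopology D_def I_def)
      show "continuous_map (subtopology (subtopology W (D k)) (G i (k - i))) E (r i (k - i))"
        if "i \<in> I k" for i
        using that cont_r[of i "k - i"] by (simp add: sub) (simp add: I_def)
      show "r i (k - i) w = r j (k - j) w"
        if "i \<in> I k" "j \<in> I k"
          "w \<in> topspace (subtopology W (D k)) \<inter> G i (k - i) \<inter> G j (k - j)" for i j w
        using that G(4)[of i "k - i" j "k - j"] by (cases "i = j") (auto simp: I_def)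
    qed blast
    have "p (\<sigma> w) = w" if w: "w \<in> D k" for w
    proof -
      obtain i where i: "i \<in> I k" "w \<in> G i (k - i)" using w unfolding D_def by blast
      then have "\<sigma> w = r i (k - i) w"
        using \<sigma>r w openin_subset[OF opD] by auto
      then show ?thesis using pr[of i "k - i" w] i by (simp add: I_def)
    qed
    then show ?thesis using \<sigma> by blast
  qed
  then obtain \<sigma> where \<sigma>: "\<And>k. continuous_map (subtopology W (D k)) E (\<sigma> k)"
    "\<And>k w. w \<in> D k \<Longrightarrow> p (\<sigma> k w) = w"
    by metis
  have "(\<Union>k\<le>m + n. D k) = topspace W"
  proof
    show "(\<Union>k\<le>m + n. D k) \<subseteq> topspace W"
      using openin_subset[OF opD] by blast
    show "topspace W \<subseteq> (\<Union>k\<le>m + n. D k)"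
    proof
      fix w assume "w \<in> topspace W"
      then obtain i j where "i \<le> m" "j \<le> n" "w \<in> G i j" using G(3) by blast
      then have "w \<in> D (i + j)" "i + j \<le> m + n"
        by (auto simp: D_def I_def intro!: bexI[of _ i])
      then show "w \<in> (\<Union>k\<le>m + n. D k)" by blast
    qed
  qed
  then have "sectional_number E W p \<le> enat (m + n)"
    unfolding sectional_number_def using opD \<sigma>
    by (intro Inf_lower) blast
  then show ?thesis by (simp add: m n)
qed

section \<open>Pairing maps in the compact-open topology\<close>

text \<open>
  If \<open>(\<alpha>, \<beta>)\<close> maps the compact set \<open>K\<close> into the open set \<open>U\<close>, regularity of \<open>K\<close> yields finitely
  many compact sets covering \<open>K\<close>, each mapped into an open box inside \<open>U\<close>; the box conditions
  bear on \<open>\<alpha>\<close> and \<open>\<beta>\<close> separately.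
\<close>

lemma continuous_map_compact_open_pair:
  assumes A: "Hausdorff_space A"
  shows "continuous_map (prod_topology (compact_open_topology A X) (compact_open_topology A Y))
    (compact_open_topology A (prod_topology X Y)) (\<lambda>(\<alpha>, \<beta>). \<lambda>t\<in>topspace A. (\<alpha> t, \<beta> t))"
    (is "continuous_map ?T _ ?c")
proof -
  have basic: "openin (compact_open_topology A Q) {h \<in> continuous_maps A Q. h ` K \<subseteq> U}"
    if "compactin A K" "openin Q U" for K U and Q :: "'q topology"
    unfolding compact_open_topology_def using that by (intro topology_generated_by_Basis) blast
  have mem: "?c (\<alpha>, \<beta>) \<in> continuous_maps A (prod_topology X Y)"
    if "\<alpha> \<in> continuous_maps A X" "\<beta> \<in> continuous_maps A Y" for \<alpha> \<beta>
  proof -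
    have "continuous_map A (prod_topology X Y) (\<lambda>t. (\<alpha> t, \<beta> t))"
      using that by (auto simp: continuous_maps_def intro: continuous_map_pairedI)
    then have "continuous_map A (prod_topology X Y) (\<lambda>t\<in>topspace A. (\<alpha> t, \<beta> t))"
      by (rule continuous_map_eq) simp
    then show ?thesis by (simp add: continuous_maps_def)
  qed
  have preim: "openin ?T (?c -` {h \<in> continuous_maps A (prod_topology X Y). h ` K \<subseteq> U} \<inter> topspace ?T)"
    if K: "compactin A K" and U: "openin (prod_topology X Y) U" for K U
    unfolding openin_prod_topology_alt
  proof (intro allI impI)
    fix \<alpha> \<beta>
    assume "(\<alpha>, \<beta>) \<in> ?c -` {h \<in> continuous_maps A (prod_topology X Y). h ` K \<subseteq> U} \<inter> topspace ?T"
    then have \<alpha>\<beta>: "\<alpha> \<in> continuous_maps A X" "\<beta> \<in> continuous_maps A Y"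
      and KU: "?c (\<alpha>, \<beta>) ` K \<subseteq> U"
      by (auto simp: topspace_compact_open_topology)
    have KA: "K \<subseteq> topspace A" by (rule compactin_subset_topspace[OF K])
    let ?K = "subtopology A K"
    have topK: "topspace ?K = K" using KA by auto
    have cK: "compact_space ?K" using K by (simp add: compactin_subspace)
    then have "regular_space ?K"
      using A Hausdorff_space_subtopology compact_Hausdorff_imp_regular_space by blast
    then have nb: "neighbourhood_base_of (closedin ?K) ?K"
      by (simp add: neighbourhood_base_of_closedin)
    have "\<exists>N C P Q. openin ?K N \<and> t \<in> N \<and> N \<subseteq> C \<and> compactin A C \<and> openin X P \<and> openin Y Q \<and>
        P \<times> Q \<subseteq> U \<and> \<alpha> ` C \<subseteq> P \<and> \<beta> ` C \<subseteq> Q" if t: "t \<in> K" for t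
    proof -
      have "(\<alpha> t, \<beta> t) \<in> U" using KU t KA by auto
      then obtain P Q where PQ: "openin X P" "openin Y Q" "\<alpha> t \<in> P" "\<beta> t \<in> Q" "P \<times> Q \<subseteq> U"
        using U unfolding openin_prod_topology_alt by meson
      have "continuous_map ?K X \<alpha>" "continuous_map ?K Y \<beta>"
        using \<alpha>\<beta> by (auto simp: continuous_maps_def intro: continuous_map_from_subtopology)
      then have "openin ?K ({t \<in> topspace ?K. \<alpha> t \<in> P} \<inter> {t \<in> topspace ?K. \<beta> t \<in> Q})"
        using PQ by (intro openin_Int openin_continuous_map_preimage) auto
      moreover have "t \<in> {t \<in> topspace ?K. \<alpha> t \<in> P} \<inter> {t \<in> topspace ?K. \<beta> t \<in> Q}"
        using t PQ topK by auto
      ultimately obtain N C where NC: "openin ?K N" "closedin ?K C" "t \<in> N" "N \<subseteq> C"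
        "C \<subseteq> {t \<in> topspace ?K. \<alpha> t \<in> P} \<inter> {t \<in> topspace ?K. \<beta> t \<in> Q}"
        using nb unfolding neighbourhood_base_of by meson
      have "compactin A C"
        using closedin_compact_space[OF cK NC(2)] by (simp add: compactin_subtopology)
      then show ?thesis using NC PQ by (intro exI[of _ N] exI[of _ C] exI[of _ P] exI[of _ Q]) auto
    qed
    then have "\<forall>t\<in>K. \<exists>N C P Q. openin ?K N \<and> t \<in> N \<and> N \<subseteq> C \<and> compactin A C \<and> openin X P \<and>
        openin Y Q \<and> P \<times> Q \<subseteq> U \<and> \<alpha> ` C \<subseteq> P \<and> \<beta> ` C \<subseteq> Q"
      by blast
    then obtain N C P Q where NC: "\<forall>t\<in>K. openin ?K (N t) \<and> t \<in> N t \<and> N t \<subseteq> C t \<and>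
        compactin A (C t) \<and> openin X (P t) \<and> openin Y (Q t) \<and> P t \<times> Q t \<subseteq> U \<and>
        \<alpha> ` C t \<subseteq> P t \<and> \<beta> ` C t \<subseteq> Q t"
      unfolding bchoice_iff by (elim exE) (rule that)
    then have N: "\<And>t. t \<in> K \<Longrightarrow> openin ?K (N t) \<and> t \<in> N t \<and> N t \<subseteq> C t"
      and C: "\<And>t. t \<in> K \<Longrightarrow> compactin A (C t)"
      and PQ: "\<And>t. t \<in> K \<Longrightarrow> openin X (P t)" "\<And>t. t \<in> K \<Longrightarrow> openin Y (Q t)"
        "\<And>t. t \<in> K \<Longrightarrow> P t \<times> Q t \<subseteq> U"
      and CPQ: "\<And>t. t \<in> K \<Longrightarrow> \<alpha> ` C t \<subseteq> P t" "\<And>t. t \<in> K \<Longrightarrow> \<beta> ` C t \<subseteq> Q t"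
      by auto
    have "compactin ?K K"
      using cK topK by (simp add: compact_space_def)
    moreover have "openin ?K N'" if "N' \<in> N ` K" for N'
      using N that by blast
    moreover have "K \<subseteq> \<Union>(N ` K)"
      using N by blast
    ultimately have "\<exists>\<F>. finite \<F> \<and> \<F> \<subseteq> N ` K \<and> K \<subseteq> \<Union>\<F>"
      by (rule compactinD)
    then obtain F where F: "F \<subseteq> K" "finite F" "K \<subseteq> (\<Union>t\<in>F. N t)"
      by (metis finite_subset_image)
    define M where "M = {h \<in> continuous_maps A X. \<forall>t\<in>F. h ` C t \<subseteq> P t}"
    define M' where "M' = {h \<in> continuous_maps A Y. \<forall>t\<in>F. h ` C t \<subseteq> Q t}"
    have fin: "openin (compact_open_topology A R) {h \<in> continuous_maps A R. \<forall>t\<in>F. h ` C t \<subseteq> O' t}"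
      if "\<And>t. t \<in> F \<Longrightarrow> openin R (O' t)" for O' and R :: "'r topology"
      using F(2,1) that
    proof (induction F rule: finite_induct)
      case empty
      show ?case using openin_topspace[of "compact_open_topology A R"]
        by (simp add: topspace_compact_open_topology)
    next
      case (insert a F)
      have "{h \<in> continuous_maps A R. \<forall>t\<in>insert a F. h ` C t \<subseteq> O' t} =
          {h \<in> continuous_maps A R. h ` C a \<subseteq> O' a} \<inter>
          {h \<in> continuous_maps A R. \<forall>t\<in>F. h ` C t \<subseteq> O' t}"
        by auto
      then show ?case using insert C by (auto intro!: openin_Int basic)
    qed
    have M_open: "openin (compact_open_topology A X) M" "openin (compact_open_topology A Y) M'"
      unfolding M_def M'_def using PQ F(1) by (auto intro!: fin)
    have \<alpha>\<beta>M: "\<alpha> \<in> M" "\<beta> \<in> M'"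
      using \<alpha>\<beta> CPQ F(1) unfolding M_def M'_def by blast+
    have "?c (a, b) ` K \<subseteq> U" if ab: "a \<in> M" "b \<in> M'" for a b
    proof
      fix z assume "z \<in> ?c (a, b) ` K"
      then obtain u where u: "u \<in> K" "z = (a u, b u)" using KA by auto
      then obtain t where t: "t \<in> F" "u \<in> C t" using F N by blast
      then have "a u \<in> P t" "b u \<in> Q t" using ab t unfolding M_def M'_def by blast+
      then show "z \<in> U" using PQ(3)[of t] t F(1) u(2) by auto
    qed
    moreover have "M \<subseteq> continuous_maps A X" "M' \<subseteq> continuous_maps A Y"
      by (auto simp: M_def M'_def)
    ultimately have "?c (a, b) \<in> {h \<in> continuous_maps A (prod_topology X Y). h ` K \<subseteq> U} \<and>
        (a, b) \<in> topspace ?T" if "a \<in> M" "b \<in> M'" for a b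
      using that mem[of a b] unfolding topspace_prod_topology topspace_compact_open_topology
      by blast
    then have "M \<times> M' \<subseteq>
        ?c -` {h \<in> continuous_maps A (prod_topology X Y). h ` K \<subseteq> U} \<inter> topspace ?T"
      by blast
    then show "\<exists>S S'. openin (compact_open_topology A X) S \<and>
        openin (compact_open_topology A Y) S' \<and> \<alpha> \<in> S \<and> \<beta> \<in> S' \<and>
        S \<times> S' \<subseteq> ?c -` {h \<in> continuous_maps A (prod_topology X Y). h ` K \<subseteq> U} \<inter> topspace ?T"
      using M_open \<alpha>\<beta>M by blast
  qed
  have im: "?c ` topspace ?T \<subseteq> topspace (compact_open_topology A (prod_topology X Y))"
    using mem by (auto simp: topspace_compact_open_topology)
  show ?thesis
    unfolding compact_open_topology_def[of A "prod_topology X Y"]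
  proof (rule continuous_on_generated_topo)
    fix S
    assume "S \<in> {{h \<in> continuous_maps A (prod_topology X Y). h ` K \<subseteq> U} |K U.
      compactin A K \<and> openin (prod_topology X Y) U}"
    then show "openin ?T (?c -` S \<inter> topspace ?T)"
      using preim by blast
  qed (use im in \<open>simp add: compact_open_topology_def\<close>)
qed

text \<open>
  \<open>pair_path (\<alpha>, \<beta>)\<close> is the path \<open>t \<mapsto> (\<alpha> t, \<beta> t)\<close>, extended by \<open>undefined\<close> outside \<open>[0,1]\<close> as
  elements of \<open>path_space\<close> are.
\<close>

definition pair_path :: "(real \<Rightarrow> 'a) \<times> (real \<Rightarrow> 'b) \<Rightarrow> real \<Rightarrow> 'a \<times> 'b" where
  "pair_path = (\<lambda>(\<alpha>, \<beta>). \<lambda>t\<in>{0..1}. (\<alpha> t, \<beta> t))"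

lemma continuous_map_pair_path:
  "continuous_map (prod_topology (path_space X) (path_space Y)) (path_space (prod_topology X Y))
     pair_path"
  using continuous_map_compact_open_pair[of "top_of_set {0..1::real}" X Y]
  by (simp add: path_space_def pair_path_def Hausdorff_space_subtopology)

section \<open>Bivariate topological complexity of products\<close>

theorem theorem2p18:
  fixes X :: "'x topology" and Y :: "'y topology" and Z :: "'z topology"
    and X' :: "'x1 topology" and Y' :: "'y1 topology" and Z' :: "'z1 topology"
    and f :: "'x \<Rightarrow> 'z" and g :: "'y \<Rightarrow> 'z"
    and f' :: "'x1 \<Rightarrow> 'z1" and g' :: "'y1 \<Rightarrow> 'z1"
  assumes "continuous_map X Z f" and "continuous_map Y Z g"
    and "continuous_map X' Z' f'" and "continuous_map Y' Z' g'"
    and "normal_space (prod_topology X (prod_topology Y (prod_topology X' Y')))"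
    and "Hausdorff_space (prod_topology X (prod_topology Y (prod_topology X' Y')))"
  shows "bivariate_TC (prod_topology X X') (prod_topology Y Y') (map_prod f f') (map_prod g g')
           \<le> bivariate_TC X Y f g + bivariate_TC X' Y' f' g'"
proof -
  let ?V = "prod_topology X (prod_topology Y (prod_topology X' Y'))"
  let ?W = "prod_topology (prod_topology X X') (prod_topology Y Y')"
  note fst_of = continuous_map_fst_of[unfolded o_def]
    and snd_of = continuous_map_snd_of[unfolded o_def]
    and fst = continuous_map_fst and snd = continuous_map_snd
  \<comment> \<open>The codomain \<open>?W\<close> of the endpoint map is the normal space \<open>?V\<close> with its factors permuted.\<close>
  have "homeomorphic_maps ?V ?W (\<lambda>w. ((fst w, fst (snd (snd w))), (fst (snd w), snd (snd (snd w)))))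
      (\<lambda>w. (fst (fst w), (fst (snd w), (snd (fst w), snd (snd w)))))"
    unfolding homeomorphic_maps_def
  proof (intro conjI ballI)
    show "continuous_map ?V ?W
        (\<lambda>w. ((fst w, fst (snd (snd w))), (fst (snd w), snd (snd (snd w)))))"
      by (intro continuous_map_pairedI fst fst_of[OF snd_of[OF snd]] fst_of[OF snd]
          snd_of[OF snd_of[OF snd]])
    show "continuous_map ?W ?V (\<lambda>w. (fst (fst w), (fst (snd w), (snd (fst w), snd (snd w)))))"
      by (intro continuous_map_pairedI fst_of[OF fst] fst_of[OF snd] snd_of[OF fst] snd_of[OF snd])
  qed auto
  then have "?V homeomorphic_space ?W" unfolding homeomorphic_space_def by blast
  then have W: "normal_space ?W" using homeomorphic_normal_space assms(5) by blast
  let ?E = "path_pairs X Y f g" and ?E' = "path_pairs X' Y' f' g'"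
  define c where "c e = (pair_path (fst (fst e), fst (snd e)), pair_path (snd (fst e), snd (snd e)))"
    for e :: "((real \<Rightarrow> 'x) \<times> (real \<Rightarrow> 'y)) \<times> ((real \<Rightarrow> 'x1) \<times> (real \<Rightarrow> 'y1))"
  have E: "continuous_map (prod_topology ?E ?E') (prod_topology (path_space X) (path_space Y)) fst"
    "continuous_map (prod_topology ?E ?E') (prod_topology (path_space X') (path_space Y')) snd"
    unfolding path_pairs_def
    using continuous_map_fst continuous_map_snd continuous_map_in_subtopology by blast+
  have "continuous_map (prod_topology ?E ?E') (path_space (prod_topology X X'))
      (\<lambda>e. pair_path (fst (fst e), fst (snd e)))"
    "continuous_map (prod_topology ?E ?E') (path_space (prod_topology Y Y'))
      (\<lambda>e. pair_path (snd (fst e), snd (snd e)))"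
    by (intro continuous_map_compose[OF _ continuous_map_pair_path, unfolded o_def]
        continuous_map_pairedI fst_of[OF E(1)] snd_of[OF E(1)] fst_of[OF E(2)] snd_of[OF E(2)])+
  then have "continuous_map (prod_topology ?E ?E')
      (prod_topology (path_space (prod_topology X X')) (path_space (prod_topology Y Y'))) c"
    unfolding c_def[abs_def] by (rule continuous_map_pairedI)
  moreover have "c e \<in> {(\<alpha>, \<beta>). \<forall>t\<in>{0..1}. map_prod f f' (\<alpha> t) = map_prod g g' (\<beta> t)}"
    if "e \<in> topspace (prod_topology ?E ?E')" for e
    using that by (auto simp: c_def pair_path_def path_pairs_def)
  ultimately have c: "continuous_map (prod_topology ?E ?E')
      (path_pairs (prod_topology X X') (prod_topology Y Y') (map_prod f f') (map_prod g g')) c"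
    unfolding path_pairs_def[of "prod_topology X X'"] continuous_map_in_subtopology by (intro conjI Pi_I)
  let ?q = "\<lambda>w. (fst (fst w), fst (snd w))" and ?q' = "\<lambda>w. (snd (fst w), snd (snd w))"
  have q: "continuous_map ?W (prod_topology X Y) ?q"
    "continuous_map ?W (prod_topology X' Y') ?q'"
    by (intro continuous_map_pairedI fst_of[OF fst] fst_of[OF snd] snd_of[OF fst] snd_of[OF snd])+
  show ?thesis
    unfolding bivariate_TC_def
  proof (rule sectional_number_le_add[OF W q c])
    show "endpoint_map (c (e, e')) = w"
      if "endpoint_map e = ?q w" "endpoint_map e' = ?q' w" for w e e'
      using that by (cases e; cases e'; cases w) (auto simp: endpoint_map_def c_def pair_path_def)
  qed
qed

end
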